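(* Let $N\ge 3$ and $d>0$ be real numbers and let $K\subset\mathbb{R}$ be the non-empty compact set satisfying $NK=K\cup(K+d)$. Then $$\mathcal{H}^s(K)=\Big(\frac{N-1}{d}\Big)^{-s},$$ where $s=\log_N 2$ is the similarity dimension of $K$.
   Context: There is a unique non-empty compact set $K\subset\mathbb{R}$ with $NK=K\cup(K+d)$. $\mathcal{H}^s$ is the Hausdorff measure without normalizing constant: $\mathcal{H}^s(E)=\lim_{\delta\to0}\inf\{\sum_{i=1}^\infty[\mathrm{diam}(U_i)]^s: E\subseteq\bigcup_{i=1}^\infty U_i,\ \mathrm{diam}(U_i)<\delta\}$. *)

theory Defs
  imports "HOL-Analysis.Analysis"
begin

text \<open>Boundedness is required because the library's \<^const>\<open>diameter\<close> is a real number and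
  hence has no meaningful value on unbounded sets, whose diameter should be infinite and which
  are therefore never admissible. Note also that \<open>0 powr 0 = 0\<close>; this only matters for
  \<open>s = 0\<close>, where the definition is not intended to be used.\<close>

definition hausdorff_premeasure :: "real \<Rightarrow> real \<Rightarrow> 'a::metric_space set \<Rightarrow> ennreal" where
  "hausdorff_premeasure s \<delta> E =
     Inf {(\<Sum>i. ennreal (diameter (U i) powr s)) | U :: nat \<Rightarrow> 'a set.
            E \<subseteq> (\<Union>i. U i) \<and> (\<forall>i. bounded (U i) \<and> diameter (U i) < \<delta>)}"

text \<open>No normalizing constant.\<close>

definition hausdorff_measure :: "real \<Rightarrow> 'a::metric_space set \<Rightarrow> ennreal" where
  "hausdorff_measure s E = Lim (at_right 0) (\<lambda>\<delta>. hausdorff_premeasure s \<delta> E)"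

lemma hausdorff_premeasure_antimono:
  assumes "\<delta> \<le> \<delta>'"
  shows "hausdorff_premeasure s \<delta>' E \<le> hausdorff_premeasure s \<delta> E"
  unfolding hausdorff_premeasure_def
  using assms by (intro Inf_superset_mono Collect_mono) (blast intro: less_le_trans)

text \<open>The limit defining the Hausdorff measure always exists.\<close>

lemma tendsto_hausdorff_premeasure_SUP:
  "((\<lambda>\<delta>. hausdorff_premeasure s \<delta> E) \<longlongrightarrow> (SUP \<delta>\<in>{0<..}. hausdorff_premeasure s \<delta> E)) (at_right 0)"
proof (rule increasing_tendsto)
  show "\<forall>\<^sub>F \<delta> in at_right 0. hausdorff_premeasure s \<delta> E \<le> (SUP \<delta>\<in>{0<..}. hausdorff_premeasure s \<delta> E)"
    using eventually_at_right_less[of "0::real"]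
    by eventually_elim (auto intro: SUP_upper)
next
  fix x assume "x < (SUP \<delta>\<in>{0<..}. hausdorff_premeasure s \<delta> E)"
  then obtain e where e: "0 < e" "x < hausdorff_premeasure s e E"
    by (auto simp: less_SUP_iff)
  show "\<forall>\<^sub>F \<delta> in at_right 0. x < hausdorff_premeasure s \<delta> E"
    unfolding eventually_at_right_field
  proof (intro exI[of _ e] conjI allI impI)
    fix y assume "y < e"
    then show "x < hausdorff_premeasure s y E"
      using e(2) hausdorff_premeasure_antimono[of y e s E] by (auto intro: less_le_trans)
  qed (use e in auto)
qed

lemma hausdorff_measure_eq_SUP:
  "hausdorff_measure s E = (SUP \<delta>\<in>{0<..}. hausdorff_premeasure s \<delta> E)"
  unfolding hausdorff_measure_def
  by (intro tendsto_Lim tendsto_hausdorff_premeasure_SUP) simp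

end

theory Submission
  imports Defs
begin

text \<open>
  Put \<open>D = d / (N - 1)\<close>. The set \<open>K\<close> is a central Cantor set with minimum \<open>0\<close> and maximum \<open>D\<close>:
  it is the union of its images under \<open>x \<mapsto> x / N\<close> and \<open>x \<mapsto> (x + d) / N\<close>, and iterating these
  two maps \<open>n\<close> times covers \<open>K\<close> by \<open>2 ^ n\<close> intervals of length \<open>D / N ^ n\<close>, the pieces of
  level \<open>n\<close>. Since \<open>N powr s = 2\<close>, the \<open>s\<close>-th powers of their lengths add up to \<open>D powr s\<close>,
  which is the upper bound (\<open>hausdorff_premeasure_le\<close>).

  The lower bound rests on a counting estimate (\<open>card_endpoints_in_le\<close>): an interval of length
  \<open>L\<close> contains at most \<open>2 ^ n * (L / D) powr s\<close> pieces of level \<open>n\<close>. It is proved by induction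
  on \<open>n\<close>. An interval containing pieces from only one of the two halves of \<open>K\<close> is rescaled by
  \<open>N\<close>. Otherwise it contains the whole central gap, and concavity of \<open>t \<mapsto> t powr s\<close> reduces the
  claim to an inequality between lengths: the gap is at least \<open>N - 2\<close> times as long as the
  mean of the two parts of the interval on either side of it.

  Any countable cover of \<open>K\<close> can be enlarged to a cover by open intervals, at a cost of at most
  \<open>\<epsilon>\<close> in the sum of the \<open>s\<close>-th powers. By compactness finitely many of them suffice, and for
  large \<open>n\<close> every piece of level \<open>n\<close> lies inside one of them (Lebesgue number). Counting the
  \<open>2 ^ n\<close> pieces with the estimate above shows that the sum is at least \<open>D powr s\<close>. This
  replaces the usual argument with the self-similar measure on \<open>K\<close> and needs no measure theory.
\<close>

section \<open>Inequalities for real powers\<close>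

lemma powr_midpoint_concave:
  fixes u v s :: real
  assumes "0 \<le> u" "0 \<le> v" "0 < s" "s \<le> 1"
  shows "u powr s + v powr s \<le> 2 * ((u + v) / 2) powr s"
proof -
  have zero: "w powr s \<le> 2 * (w / 2) powr s" if "0 \<le> w" for w
  proof -
    have "(2::real) powr s \<le> 2 powr 1"
      using assms by (intro powr_mono) auto
    then have "w powr s * 2 powr s \<le> w powr s * 2"
      by (intro mult_left_mono) auto
    then show ?thesis
      using that by (simp add: powr_divide field_simps)
  qed
  show ?thesis
  proof (cases "u = 0 \<or> v = 0")
    case True
    then show ?thesis
      using zero[of u] zero[of v] assms by auto
  next
    case False
    then have pos: "0 < u powr s" "0 < v powr s" by auto
    \<comment> \<open>Convexity of the inverse function \<open>t \<mapsto> t powr (1 / s)\<close>.\<close>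
    have "((u powr s + v powr s) / 2) powr (1 / s)
        \<le> (1/2) * (u powr s) powr (1 / s) + (1/2) * (v powr s) powr (1 / s)"
      using convex_onD[OF powr_convex[of "1 / s"], of "1/2" "u powr s" "v powr s"] pos assms
      by (simp add: add_divide_distrib)
    also have "\<dots> = (u + v) / 2"
      using assms by (simp add: powr_powr)
    finally have "(((u powr s + v powr s) / 2) powr (1 / s)) powr s \<le> ((u + v) / 2) powr s"
      using assms by (intro powr_mono2) auto
    moreover have "(((u powr s + v powr s) / 2) powr (1 / s)) powr s = (u powr s + v powr s) / 2"
      using assms pos by (simp add: powr_powr)
    ultimately show ?thesis by simp
  qed
qed

lemma ex_pos_powr_increment_less:
  fixes x s e :: real
  assumes "0 \<le> x" "0 < s" "0 < e"
  shows "\<exists>h>0. (x + 2 * h) powr s < x powr s + e"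
proof -
  have "((\<lambda>h. (x + 2 * h) powr s) \<longlongrightarrow> (x + 2 * 0) powr s) (at_right 0)"
    using assms
    by (intro tendsto_powr' tendsto_intros)
       (auto simp: eventually_at_filter intro!: always_eventually)
  then have "\<forall>\<^sub>F h in at_right 0. (x + 2 * h) powr s < x powr s + e"
    by (rule order_tendstoD) (use assms in simp)
  then have "\<forall>\<^sub>F h in at_right 0. 0 < h \<and> (x + 2 * h) powr s < x powr s + e"
    using eventually_at_right_less[of "0::real"] by eventually_elim simp
  then show ?thesis
    using eventually_happens'[OF trivial_limit_at_right_real] by blast
qed

section \<open>The Cantor set and its pieces\<close>

text \<open>A non-empty compact set satisfying the self-similarity equation. For \<open>N > 2\<close> the two halves
  of \<open>K\<close> are separated by a gap. The number \<open>D\<close> is the diameter of \<open>K\<close> and \<open>s\<close> is its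
  similarity dimension.\<close>

locale cantor_set =
  fixes N d D s :: real and K :: "real set"
  assumes N_gt_2: "2 < N" and d_pos: "0 < d"
    and K_nonempty: "K \<noteq> {}" and K_compact: "compact K"
    and K_eq: "(\<lambda>x. N * x) ` K = K \<union> (\<lambda>x. x + d) ` K"
  defines "D \<equiv> d / (N - 1)" and "s \<equiv> log N 2"
begin

lemma D_pos: "0 < D" and d_eq: "d = (N - 1) * D"
  using N_gt_2 d_pos by (auto simp: D_def)

lemma D_less_d: "D < d"
proof -
  have "0 < (N - 2) * D" using N_gt_2 D_pos by simp
  then show ?thesis unfolding d_eq by (simp add: algebra_simps)
qed

lemma s_pos: "0 < s" and s_le_1: "s \<le> 1" and N_powr_s: "N powr s = 2"
  using N_gt_2 by (auto simp: s_def)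

lemma K_closed_left: "x \<in> K \<Longrightarrow> x / N \<in> K"
proof -
  assume "x \<in> K"
  then obtain y where "y \<in> K" "x = N * y" using K_eq by blast
  then show ?thesis using N_gt_2 by simp
qed

lemma K_closed_right: "x \<in> K \<Longrightarrow> (x + d) / N \<in> K"
proof -
  assume "x \<in> K"
  then have "x + d \<in> (\<lambda>x. N * x) ` K" using K_eq by blast
  then obtain y where "y \<in> K" "x + d = N * y" by blast
  then show ?thesis using N_gt_2 by simp
qed

lemma K_cases:
  assumes "x \<in> K"
  obtains "N * x \<in> K" | "N * x - d \<in> K"
proof -
  have "N * x \<in> K \<union> (\<lambda>x. x + d) ` K" using assms K_eq by blast
  then show ?thesis using that by auto
qed

lemma zero_in_K: "0 \<in> K" and K_subset: "K \<subseteq> {0..D}"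
proof -
  obtain m where m: "m \<in> K" "\<And>x. x \<in> K \<Longrightarrow> m \<le> x"
    using compact_attains_inf[OF K_compact K_nonempty] by blast
  obtain M where M: "M \<in> K" "\<And>x. x \<in> K \<Longrightarrow> x \<le> M"
    using compact_attains_sup[OF K_compact K_nonempty] by blast
  have "m \<le> m / N" using m K_closed_left by blast
  then have "m * (N - 1) \<le> 0" using N_gt_2 by (simp add: field_simps)
  then have "m \<le> 0" using N_gt_2 by (simp add: mult_le_0_iff)
  moreover have "m \<le> N * m"
    using m(1) by (rule K_cases) (use m(2) d_pos in force)+
  then have "0 \<le> m * (N - 1)" by (simp add: algebra_simps)
  then have "0 \<le> m" using N_gt_2 by (simp add: zero_le_mult_iff)
  ultimately have "m = 0" by simp
  have "N * M \<le> M + d"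
    using M(1) by (rule K_cases) (use M(2) d_pos in force)+
  then have "M \<le> D" using N_gt_2 by (simp add: D_def field_simps)
  show "0 \<in> K" using m(1) \<open>m = 0\<close> by simp
  show "K \<subseteq> {0..D}" using m(2) \<open>m = 0\<close> M(2) \<open>M \<le> D\<close> by force
qed

text \<open>The left endpoints of the pieces of level \<open>n\<close>, that is, of the \<open>2 ^ n\<close> intervals of length
  \<open>D / N ^ n\<close> that remain after \<open>n\<close> steps of the construction. A piece is represented by its
  left endpoint throughout.\<close>

fun endpoints :: "nat \<Rightarrow> real set" where
  "endpoints 0 = {0}"
| "endpoints (Suc n) = (\<lambda>a. a / N) ` endpoints n \<union> (\<lambda>a. (a + d) / N) ` endpoints n"

lemma finite_endpoints: "finite (endpoints n)"
  by (induction n) auto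

lemma endpoints_subset_K: "endpoints n \<subseteq> K"
  by (induction n) (auto simp: zero_in_K K_closed_left K_closed_right)

lemma endpoints_nonneg: "a \<in> endpoints n \<Longrightarrow> 0 \<le> a"
  using endpoints_subset_K K_subset by force

lemma right_end_left_child: "a / N + D / N ^ Suc n = (a + D / N ^ n) / N"
  and right_end_right_child: "(a + d) / N + D / N ^ Suc n = (a + D / N ^ n + d) / N"
  by (simp_all add: add_divide_distrib mult.commute)

lemma endpoints_le: "a \<in> endpoints n \<Longrightarrow> a + D / N ^ n \<le> D"
proof (induction n arbitrary: a)
  case (Suc n)
  from Suc.prems consider b where "b \<in> endpoints n" "a = b / N"
    | b where "b \<in> endpoints n" "a = (b + d) / N" by auto
  then show ?case
  proof cases
    case 1
    have "a + D / N ^ Suc n = (b + D / N ^ n) / N"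
      unfolding 1(2) by (rule right_end_left_child)
    also have "\<dots> \<le> D / N"
      using Suc.IH[OF 1(1)] N_gt_2 by (simp add: divide_right_mono)
    also have "\<dots> \<le> D"
      using N_gt_2 D_pos by (simp add: divide_le_eq)
    finally show ?thesis .
  next
    case 2
    have "a + D / N ^ Suc n = (b + D / N ^ n + d) / N"
      unfolding 2(2) by (rule right_end_right_child)
    also have "\<dots> \<le> (D + d) / N"
      using Suc.IH[OF 2(1)] N_gt_2 by (simp add: divide_right_mono)
    also have "\<dots> = D"
      using N_gt_2 by (simp add: d_eq field_simps)
    finally show ?thesis .
  qed
qed simp

lemma card_endpoints: "card (endpoints n) = 2 ^ n"
proof (induction n)
  case (Suc n)
  have "a \<noteq> b + d" if "a \<in> endpoints n" "b \<in> endpoints n" for a b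
  proof -
    have "a \<le> D" using that endpoints_subset_K K_subset by force
    then show ?thesis using D_less_d endpoints_nonneg[OF that(2)] by simp
  qed
  then have "(\<lambda>a. a / N) ` endpoints n \<inter> (\<lambda>a. (a + d) / N) ` endpoints n = {}"
    using N_gt_2 by auto
  moreover have "card ((\<lambda>a. a / N) ` endpoints n) = 2 ^ n"
    using N_gt_2 Suc.IH by (subst card_image) (auto simp: inj_on_def)
  moreover have "card ((\<lambda>a. (a + d) / N) ` endpoints n) = 2 ^ n"
    using N_gt_2 Suc.IH by (subst card_image) (auto simp: inj_on_def)
  ultimately show ?case
    by (simp add: card_Un_disjoint finite_endpoints)
qed simp

lemma K_covered: "x \<in> K \<Longrightarrow> \<exists>a\<in>endpoints n. x \<in> {a..a + D / N ^ n}"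
proof (induction n arbitrary: x)
  case 0
  then show ?case using K_subset by auto
next
  case (Suc n)
  from Suc.prems show ?case
  proof (cases rule: K_cases)
    case 1
    then obtain a where "a \<in> endpoints n" "N * x \<in> {a..a + D / N ^ n}"
      using Suc.IH by blast
    then show ?thesis
      using N_gt_2 right_end_left_child[of a n]
      by (intro bexI[of _ "a / N"]) (auto simp: pos_divide_le_eq pos_le_divide_eq mult.commute)
  next
    case 2
    then obtain a where "a \<in> endpoints n" "N * x - d \<in> {a..a + D / N ^ n}"
      using Suc.IH by blast
    then show ?thesis
      using N_gt_2 right_end_right_child[of a n]
      by (intro bexI[of _ "(a + d) / N"]) (auto simp: pos_divide_le_eq pos_le_divide_eq mult.commute)
  qed
qed

section \<open>Counting the pieces inside an interval\<close>

text \<open>The (left endpoints of) pieces of level \<open>n\<close> that lie entirely inside \<open>[x, y]\<close>.\<close>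

definition endpoints_in :: "nat \<Rightarrow> real \<Rightarrow> real \<Rightarrow> real set" where
  "endpoints_in n x y = {a \<in> endpoints n. x \<le> a \<and> a + D / N ^ n \<le> y}"

lemma finite_endpoints_in: "finite (endpoints_in n x y)"
  by (simp add: endpoints_in_def finite_endpoints)

lemma endpoints_in_Suc:
  "endpoints_in (Suc n) x y =
    (\<lambda>a. a / N) ` endpoints_in n (N * x) (N * y) \<union>
    (\<lambda>a. (a + d) / N) ` endpoints_in n (N * x - d) (N * y - d)"
proof -
  have left: "a / N \<in> endpoints_in (Suc n) x y \<longleftrightarrow> a \<in> endpoints_in n (N * x) (N * y)"
    if "a \<in> endpoints n" for a
    using that N_gt_2 unfolding endpoints_in_def mem_Collect_eq right_end_left_child
    by (simp add: pos_divide_le_eq pos_le_divide_eq mult.commute)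
  have right: "(a + d) / N \<in> endpoints_in (Suc n) x y \<longleftrightarrow>
      a \<in> endpoints_in n (N * x - d) (N * y - d)" if "a \<in> endpoints n" for a
    using that N_gt_2 unfolding endpoints_in_def mem_Collect_eq right_end_right_child
    by (auto simp: pos_divide_le_eq pos_le_divide_eq mult.commute)
  have sub: "a \<in> endpoints m" if "a \<in> endpoints_in m x' y'" for a m x' y'
    using that by (simp add: endpoints_in_def)
  show ?thesis (is "?L = ?R")
  proof (intro equalityI subsetI)
    fix c assume c: "c \<in> ?L"
    from sub[OF c] consider a where "a \<in> endpoints n" "c = a / N"
      | a where "a \<in> endpoints n" "c = (a + d) / N" by auto
    then show "c \<in> ?R"
      by cases (use c left right in blast)+
  next
    fix c assume "c \<in> ?R"
    then show "c \<in> ?L" using left right sub by blast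
  qed
qed

lemma card_endpoints_in_Suc_le:
  "card (endpoints_in (Suc n) x y) \<le>
    card (endpoints_in n (N * x) (N * y)) + card (endpoints_in n (N * x - d) (N * y - d))"
  unfolding endpoints_in_Suc
  by (rule order.trans[OF card_Un_le]) (intro add_mono card_image_le finite_endpoints_in)

lemma endpoints_in_clip: "endpoints_in n x y = endpoints_in n (max x 0) (min y D)"
  using endpoints_nonneg endpoints_le by (auto simp: endpoints_in_def)

lemma scaled_powr:
  assumes "0 \<le> x"
  shows "(N * x / D) powr s = 2 * (x / D) powr s"
  using assms N_gt_2 D_pos N_powr_s powr_mult[of N "x / D" s] by simp

text \<open>The key estimate: with the uniform weight \<open>2 powr (- n)\<close> on each piece of level \<open>n\<close>, the
  pieces inside an interval of length \<open>L\<close> have total weight at most \<open>(L / D) powr s\<close>. The constant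
  is sharp, which is why the exact value of the Hausdorff measure comes out.\<close>

lemma card_endpoints_in_le:
  assumes "x \<le> y"
  shows "real (card (endpoints_in n x y)) \<le> 2 ^ n * ((y - x) / D) powr s"
  using assms
proof (induction n arbitrary: x y)
  case 0
  show ?case
  proof (cases "x \<le> 0 \<and> D \<le> y")
    case True
    then have "1 powr s \<le> ((y - x) / D) powr s"
      using D_pos s_pos by (intro powr_mono2) (auto simp: field_simps)
    moreover have "card (endpoints_in 0 x y) \<le> card {0::real}"
      by (intro card_mono) (auto simp: endpoints_in_def)
    ultimately show ?thesis by simp
  next
    case False
    then have "endpoints_in 0 x y = {}" by (auto simp: endpoints_in_def)
    then show ?thesis by simp
  qed
next
  case (Suc n)
  define A where "A = endpoints_in n (N * x) (N * y)"
  define B where "B = endpoints_in n (N * x - d) (N * y - d)"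
  have card_le: "real (card (endpoints_in (Suc n) x y)) \<le> real (card A) + real (card B)"
    using card_endpoints_in_Suc_le[of n x y] unfolding A_def B_def by linarith
  have Nxy: "N * x \<le> N * y" using Suc.prems N_gt_2 by simp
  have single: "2 ^ n * ((N * y - N * x) / D) powr s = 2 ^ Suc n * ((y - x) / D) powr s"
    using scaled_powr[of "y - x"] Suc.prems by (simp add: right_diff_distrib)
  have A_le: "real (card A) \<le> 2 ^ Suc n * ((y - x) / D) powr s"
    using Suc.IH[OF Nxy] single by (simp add: A_def)
  have B_le: "real (card B) \<le> 2 ^ Suc n * ((y - x) / D) powr s"
    using Suc.IH[of "N * x - d" "N * y - d"] Nxy single by (simp add: B_def)
  \<comment> \<open>If only one half contributes, the bound is inherited because \<open>N powr s = 2\<close>.\<close>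
  show ?case
  proof (cases "A = {} \<or> B = {}")
    case True
    then show ?thesis using card_le A_le B_le by auto
  next
    case False
    then obtain a b where a: "a \<in> A" and b: "b \<in> B" by blast
    have piece_pos: "0 < D / N ^ n" using N_gt_2 D_pos by simp
    have x: "N * x \<le> D"
      using a piece_pos endpoints_le[of a n] by (auto simp: A_def endpoints_in_def)
    have y: "d \<le> N * y"
      using b piece_pos endpoints_nonneg[of b n] by (auto simp: B_def endpoints_in_def)
    \<comment> \<open>\<open>[x, y]\<close> bridges the gap between the two halves. After rescaling by \<open>N\<close>, it covers the
      final segment of length \<open>u\<close> of \<open>[0, D]\<close> in the left half, and the initial segment of
      length \<open>v\<close> in the right half.\<close>
    define u where "u = D - max (N * x) 0"
    define v where "v = min (N * y - d) D"
    have uv: "0 \<le> u" "u \<le> D" "u \<le> D - N * x" "0 \<le> v" "v \<le> D" "v \<le> N * y - d"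
      using x y D_pos by (auto simp: u_def v_def)
    have "A = endpoints_in n (max (N * x) 0) D"
      using y D_less_d unfolding A_def by (subst endpoints_in_clip) (simp add: min_def)
    then have A: "real (card A) \<le> 2 ^ n * (u / D) powr s"
      using Suc.IH[of "max (N * x) 0" D] x D_pos by (simp add: u_def)
    have "B = endpoints_in n 0 v"
      using x D_less_d unfolding B_def v_def by (subst endpoints_in_clip) (simp add: max_def)
    then have B: "real (card B) \<le> 2 ^ n * (v / D) powr s"
      using Suc.IH[of 0 v] uv by simp
    \<comment> \<open>The rescaled gap has length \<open>d - D = (N - 2) * D\<close>, which is at least \<open>N - 2\<close> times the
      mean of \<open>u\<close> and \<open>v\<close>; hence \<open>N\<close> times this mean fits into \<open>N * (y - x)\<close>.\<close>
    have "(N - 2) * ((u + v) / 2) \<le> (N - 2) * D"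
      using uv N_gt_2 by (intro mult_left_mono) auto
    moreover have "u + v \<le> N * (y - x) - (N - 2) * D"
      using uv by (simp add: d_eq algebra_simps)
    moreover have "(u + v) + (N - 2) * ((u + v) / 2) = N * ((u + v) / 2)"
      by (simp add: field_simps)
    ultimately have "N * ((u + v) / 2) \<le> N * (y - x)" by linarith
    then have half: "(u + v) / 2 \<le> y - x" using N_gt_2 by simp
    have "(u / D) powr s + (v / D) powr s \<le> 2 * ((u / D + v / D) / 2) powr s"
      using uv D_pos s_pos s_le_1 by (intro powr_midpoint_concave) auto
    also have "\<dots> = 2 * (((u + v) / 2) / D) powr s"
      by (simp add: add_divide_distrib mult.commute)
    also have "\<dots> \<le> 2 * ((y - x) / D) powr s"
      using half uv D_pos s_pos by (intro mult_left_mono powr_mono2 divide_right_mono) auto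
    finally have "2 ^ n * ((u / D) powr s + (v / D) powr s) \<le> 2 ^ n * (2 * ((y - x) / D) powr s)"
      by (intro mult_left_mono) auto
    then show ?thesis using card_le A B by (simp add: algebra_simps)
  qed
qed

section \<open>The lower bound\<close>

lemma piece_length_tendsto: "(\<lambda>n. D / N ^ n) \<longlonglongrightarrow> 0"
proof -
  have "(\<lambda>n. D * (1 / N) ^ n) \<longlonglongrightarrow> D * 0"
    using N_gt_2 by (intro tendsto_intros LIMSEQ_power_zero) auto
  then show ?thesis by (simp add: power_divide)
qed

lemma ex_piece_length_less: "0 < e \<Longrightarrow> \<exists>n. D / N ^ n < e"
  using eventually_happens'[OF sequentially_bot order_tendstoD(2)[OF piece_length_tendsto]]
  by blast

lemma sum_interval_powr_ge:
  fixes x y :: "nat \<Rightarrow> real"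
  assumes "finite F" and "K \<subseteq> (\<Union>i\<in>F. {x i<..<y i})"
    and "\<And>i. i \<in> F \<Longrightarrow> x i \<le> y i"
  shows "D powr s \<le> (\<Sum>i\<in>F. (y i - x i) powr s)"
proof -
  \<comment> \<open>A Lebesgue number of the cover.\<close>
  obtain e where e: "0 < e"
    "\<And>z. z \<in> K \<Longrightarrow> \<exists>G\<in>(\<lambda>i. {x i<..<y i}) ` F. ball z e \<subseteq> G"
    by (rule Heine_Borel_lemma[OF K_compact assms(2)]) auto
  obtain n where n: "D / N ^ n < e" using ex_piece_length_less e(1) by blast
  have "endpoints n \<subseteq> (\<Union>i\<in>F. endpoints_in n (x i) (y i))"
  proof
    fix a assume a: "a \<in> endpoints n"
    then obtain i where i: "i \<in> F" "ball a e \<subseteq> {x i<..<y i}"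
      using e(2)[of a] endpoints_subset_K by blast
    have "a \<in> ball a e" "a + D / N ^ n \<in> ball a e"
      using e(1) n N_gt_2 D_pos by (auto simp: dist_real_def)
    then have "a \<in> {x i<..<y i}" "a + D / N ^ n \<in> {x i<..<y i}"
      using i(2) by blast+
    then show "a \<in> (\<Union>i\<in>F. endpoints_in n (x i) (y i))"
      using i(1) a by (auto simp: endpoints_in_def intro!: bexI[of _ i])
  qed
  then have "card (endpoints n) \<le> card (\<Union>i\<in>F. endpoints_in n (x i) (y i))"
    using assms(1) finite_endpoints_in by (intro card_mono) auto
  also have "\<dots> \<le> (\<Sum>i\<in>F. card (endpoints_in n (x i) (y i)))"
    by (rule card_UN_le[OF assms(1)])
  finally have "real (2 ^ n) \<le> real (\<Sum>i\<in>F. card (endpoints_in n (x i) (y i)))"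
    unfolding card_endpoints of_nat_le_iff .
  also have "\<dots> \<le> (\<Sum>i\<in>F. 2 ^ n * ((y i - x i) / D) powr s)"
    unfolding of_nat_sum using assms(3) by (intro sum_mono card_endpoints_in_le)
  also have "\<dots> = (\<Sum>i\<in>F. 2 ^ n * ((y i - x i) powr s / D powr s))"
    using assms(3) D_pos by (intro sum.cong) (auto simp: powr_divide)
  also have "\<dots> = 2 ^ n * ((\<Sum>i\<in>F. (y i - x i) powr s) / D powr s)"
    by (simp add: sum_distrib_left sum_divide_distrib)
  finally show ?thesis using D_pos by (simp add: field_simps)
qed

lemma suminf_diameter_powr_ge:
  fixes U :: "nat \<Rightarrow> real set"
  assumes "K \<subseteq> (\<Union>i. U i)" and "\<And>i. bounded (U i)"
  shows "ennreal (D powr s) \<le> (\<Sum>i. ennreal (diameter (U i) powr s))"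
proof (rule ennreal_le_epsilon)
  fix e :: real assume "0 < e"
  define L where "L i = diameter (U i)" for i
  have L_nonneg: "0 \<le> L i" for i
    using diameter_ge_0[OF assms(2)] by (simp add: L_def)
  have "\<exists>h>0. (L i + 2 * h) powr s < L i powr s + e * (1/2) ^ Suc i" for i
    using \<open>0 < e\<close> L_nonneg s_pos by (intro ex_pos_powr_increment_less) auto
  then obtain h where h: "\<And>i. 0 < h i"
    "\<And>i. (L i + 2 * h i) powr s < L i powr s + e * (1/2) ^ Suc i"
    by metis
  \<comment> \<open>An empty \<open>U i\<close> also gets an interval; its position is then irrelevant.\<close>
  define x where "x i = Inf (U i) - h i" for i
  define y where "y i = Inf (U i) + L i + h i" for i
  have xy: "x i \<le> y i" "y i - x i = L i + 2 * h i" for i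
    using h(1)[of i] L_nonneg[of i] by (auto simp: x_def y_def)
  have "U i \<subseteq> {x i<..<y i}" for i
  proof
    fix u assume u: "u \<in> U i"
    have "Inf (U i) \<le> u"
      using u assms(2) by (intro cInf_lower bounded_imp_bdd_below)
    moreover have "u - L i \<le> v" if "v \<in> U i" for v
      using diameter_bounded_bound[OF assms(2) u that] by (simp add: L_def dist_real_def)
    then have "u - L i \<le> Inf (U i)"
      using u by (intro cInf_greatest) auto
    ultimately show "u \<in> {x i<..<y i}"
      using h(1)[of i] by (simp add: x_def y_def)
  qed
  then have cover: "K \<subseteq> (\<Union>i\<in>UNIV. {x i<..<y i})"
    by (intro order.trans[OF assms(1)] UN_mono order.refl)
  obtain F where F: "finite F" "K \<subseteq> (\<Union>i\<in>F. {x i<..<y i})"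
    by (rule compactE_image[OF K_compact _ cover]) auto
  have "(\<Sum>i\<in>F. (1/2) ^ Suc i) \<le> (\<Sum>i. (1/2::real) ^ Suc i)"
    by (intro sum_le_suminf[OF sums_summable[OF power_half_series] F(1)]) auto
  also have "\<dots> = 1"
    using sums_unique[OF power_half_series] by simp
  finally have "e * (\<Sum>i\<in>F. (1/2) ^ Suc i) \<le> e"
    using \<open>0 < e\<close> by simp
  then have tail: "(\<Sum>i\<in>F. e * (1/2) ^ Suc i) \<le> e"
    by (simp only: sum_distrib_left)
  have "D powr s \<le> (\<Sum>i\<in>F. (y i - x i) powr s)"
    by (intro sum_interval_powr_ge F xy)
  also have "\<dots> \<le> (\<Sum>i\<in>F. L i powr s + e * (1/2) ^ Suc i)"
    unfolding xy(2) by (intro sum_mono less_imp_le h)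
  also have "\<dots> \<le> (\<Sum>i\<in>F. L i powr s) + e"
    using tail by (simp only: sum.distrib add_left_mono)
  finally have "D powr s \<le> (\<Sum>i\<in>F. L i powr s) + e" .
  then have "ennreal (D powr s) \<le> ennreal (\<Sum>i\<in>F. L i powr s) + ennreal e"
    using \<open>0 < e\<close> by (simp add: ennreal_plus[symmetric] sum_nonneg del: ennreal_plus)
  moreover have "ennreal (\<Sum>i\<in>F. L i powr s) \<le> (\<Sum>i. ennreal (L i powr s))"
  proof -
    have "ennreal (\<Sum>i\<in>F. L i powr s) = (\<Sum>i\<in>F. ennreal (L i powr s))"
      by (simp add: sum_ennreal)
    also have "\<dots> \<le> (\<Sum>i. ennreal (L i powr s))"
      using F(1) by (intro sum_le_suminf) auto
    finally show ?thesis .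
  qed
  ultimately show "ennreal (D powr s) \<le> (\<Sum>i. ennreal (diameter (U i) powr s)) + ennreal e"
    unfolding L_def by (meson add_right_mono order.trans)
qed

section \<open>The upper bound and the value of the measure\<close>

lemma hausdorff_premeasure_le:
  assumes "0 < \<delta>"
  shows "hausdorff_premeasure s \<delta> K \<le> ennreal (D powr s)"
proof -
  obtain n where n: "D / N ^ n < \<delta>" using ex_piece_length_less assms by blast
  obtain f where f: "bij_betw f {..<(2::nat) ^ n} (endpoints n)"
    using ex_bij_betw_nat_finite[OF finite_endpoints, of n]
    by (auto simp: card_endpoints lessThan_atLeast0)
  \<comment> \<open>The pieces of level \<open>n\<close>, padded with empty sets, which contribute \<open>0 powr s = 0\<close>.\<close>
  define U where "U i = (if i < 2 ^ n then {f i..f i + D / N ^ n} else {})" for i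
  have len_pos: "0 < D / N ^ n" using N_gt_2 D_pos by simp
  have diam: "diameter (U i) = (if i < 2 ^ n then D / N ^ n else 0)" for i
    using len_pos by (auto simp: U_def)
  have "K \<subseteq> (\<Union>i. U i)"
  proof
    fix x assume "x \<in> K"
    then obtain a where a: "a \<in> endpoints n" "x \<in> {a..a + D / N ^ n}"
      using K_covered by blast
    then obtain i where "i < 2 ^ n" "f i = a"
      using bij_betw_imp_surj_on[OF f] by (metis imageE lessThan_iff)
    then show "x \<in> (\<Union>i. U i)" using a(2) by (auto simp: U_def intro!: exI[of _ i])
  qed
  moreover have "\<forall>i. bounded (U i) \<and> diameter (U i) < \<delta>"
    unfolding diam using n assms by (auto simp: U_def)
  ultimately have "hausdorff_premeasure s \<delta> K \<le> (\<Sum>i. ennreal (diameter (U i) powr s))"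
    unfolding hausdorff_premeasure_def by (intro Inf_lower) blast
  also have "\<dots> = (\<Sum>i<2 ^ n. ennreal (diameter (U i) powr s))"
    by (intro suminf_finite) (auto simp: diam)
  also have "\<dots> = (\<Sum>i<(2::nat) ^ n. ennreal ((D / N ^ n) powr s))"
    by (intro sum.cong) (auto simp: diam)
  also have "\<dots> = ennreal (2 ^ n * (D / N ^ n) powr s)"
    by (simp add: ennreal_mult ennreal_power[symmetric])
  also have "2 ^ n * (D / N ^ n) powr s = D powr s"
  proof -
    have "(N ^ n) powr s = (N powr s) ^ n"
      using N_gt_2 by (simp add: powr_realpow[symmetric] powr_powr mult.commute)
    then show ?thesis
      using N_gt_2 D_pos N_powr_s by (simp add: powr_divide)
  qed
  finally show ?thesis .
qed

theorem hausdorff_measure_K: "hausdorff_measure s K = ennreal (D powr s)"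
  unfolding hausdorff_measure_eq_SUP
proof (rule antisym)
  show "(SUP \<delta>\<in>{0<..}. hausdorff_premeasure s \<delta> K) \<le> ennreal (D powr s)"
    by (intro SUP_least hausdorff_premeasure_le) simp
  have "ennreal (D powr s) \<le> hausdorff_premeasure s 1 K"
    unfolding hausdorff_premeasure_def
    by (intro Inf_greatest) (auto intro!: suminf_diameter_powr_ge)
  also have "\<dots> \<le> (SUP \<delta>\<in>{0<..}. hausdorff_premeasure s \<delta> K)"
    by (intro SUP_upper) simp
  finally show "ennreal (D powr s) \<le> (SUP \<delta>\<in>{0<..}. hausdorff_premeasure s \<delta> K)" .
qed

end

theorem proposition5p3:
  fixes N d s :: real and K :: "real set"
  assumes "N \<ge> 3" and "d > 0"
    and "K \<noteq> {}" and "compact K"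
    and "(\<lambda>x. N * x) ` K = K \<union> (\<lambda>x. x + d) ` K"
    and "s = log N 2"
  shows "hausdorff_measure s K = ennreal (((N - 1) / d) powr (- s))"
proof -
  interpret cantor_set N d "d / (N - 1)" "log N 2" K
    by unfold_locales (use assms in auto)
  have "(d / (N - 1)) powr s = ((N - 1) / d) powr (- s)"
    using assms by (simp add: powr_minus powr_divide)
  then show ?thesis
    using hausdorff_measure_K assms(6) by simp
qed

end
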